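(* Let $k \ge 4$ be an integer. Then for every integer $r$ with $k < r \le 2k-3$ and every integer $n > r$, there exists a primitive uniquely $K_r^{(k)}$-saturated $k$-uniform hypergraph on $n$ vertices.
   Context: $K_r^{(k)}$ denotes the complete $k$-uniform hypergraph on $r$ vertices. A $k$-uniform hypergraph $H$ is uniquely $K_r^{(k)}$-saturated if $H$ contains no copy of $K_r^{(k)}$ (i.e., no $r$-set of vertices all of whose $k$-subsets are edges), and for every $k$-subset $S$ of $V(H)$ that is not an edge of $H$, the hypergraph $H+S$ contains exactly one copy of $K_r^{(k)}$. A vertex $v$ is dominating in $H$ if every $k$-subset of $V(H)$ containing $v$ is an edge of $H$. $H$ is primitive uniquely $K_r^{(k)}$-saturated if it is uniquely $K_r^{(k)}$-saturated and has no dominating vertex. *)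

theory Defs
  imports Main "HOL-Library.Ramsey"
begin

text \<open>A hypergraph is given by its vertex set \<open>V\<close> and its edge set \<open>E\<close>;
  \<^term>\<open>nsets V k\<close> is the set of all \<open>k\<close>-element subsets of \<open>V\<close>.\<close>

definition uniform_hypergraph :: "nat \<Rightarrow> 'a set \<Rightarrow> 'a set set \<Rightarrow> bool" where
  "uniform_hypergraph k V E \<longleftrightarrow> finite V \<and> E \<subseteq> nsets V k"

text \<open>A copy of \<open>K\<^sub>r\<^sup>(\<^sup>k\<^sup>)\<close> is identified with its vertex set.\<close>

definition clique_copies :: "nat \<Rightarrow> nat \<Rightarrow> 'a set \<Rightarrow> 'a set set \<Rightarrow> 'a set set" where
  "clique_copies k r V E = {R \<in> nsets V r. nsets R k \<subseteq> E}"

definition uniquely_saturated :: "nat \<Rightarrow> nat \<Rightarrow> 'a set \<Rightarrow> 'a set set \<Rightarrow> bool" where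
  "uniquely_saturated k r V E \<longleftrightarrow>
     uniform_hypergraph k V E \<and>
     clique_copies k r V E = {} \<and>
     (\<forall>S \<in> nsets V k - E. \<exists>!R. R \<in> clique_copies k r V (insert S E))"

definition dominating :: "nat \<Rightarrow> 'a set \<Rightarrow> 'a set set \<Rightarrow> 'a \<Rightarrow> bool" where
  "dominating k V E v \<longleftrightarrow> v \<in> V \<and> (\<forall>S \<in> nsets V k. v \<in> S \<longrightarrow> S \<in> E)"

definition primitive_uniquely_saturated :: "nat \<Rightarrow> nat \<Rightarrow> 'a set \<Rightarrow> 'a set set \<Rightarrow> bool" where
  "primitive_uniquely_saturated k r V E \<longleftrightarrow>
     uniquely_saturated k r V E \<and> (\<nexists>v. dominating k V E v)"

end

theory Submission
  imports Defs
begin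

text \<open>Write \<open>r = k + t\<close> and split the vertices into a core \<open>C\<close> of size \<open>t + 1\<close> and a rest \<open>X\<close>.
  Colour the \<open>(k-1)\<close>-subsets \<open>Y\<close> of \<open>X\<close> by elements \<open>f Y\<close> of \<open>C\<close> such that every colour occurs
  and \<open>f Y = c0\<close> exactly when \<open>Y\<close> does not contain both of two fixed vertices \<open>p\<close>, \<open>q\<close>.
  The non-edges are the sets \<open>Y \<union> {f Y}\<close> and the \<open>k\<close>-subsets \<open>Z\<close> of \<open>X\<close> on which \<open>f\<close> is constant,
  that is, those not containing both \<open>p\<close> and \<open>q\<close>. The only \<open>r\<close>-sets with a single non-edge are then
  \<open>Y \<union> C\<close> and \<open>Z \<union> (C - {c0})\<close>, and every other \<open>r\<close>-set contains at least two non-edges.\<close>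

locale core_colouring =
  fixes k t :: nat and X C :: "'a set" and c0 p q :: 'a and f :: "'a set \<Rightarrow> 'a"
  assumes k: "k \<ge> 4"
    and finX: "finite X" and cardX: "card X \<ge> k"
    and finC: "finite C" and cardC: "card C = t + 1"
    and disj: "X \<inter> C = {}"
    and c0: "c0 \<in> C" and pq: "p \<noteq> q"
    and onto: "f ` nsets X (k - 1) = C"
    and f_c0: "\<And>Y. Y \<in> nsets X (k - 1) \<Longrightarrow> f Y = c0 \<longleftrightarrow> \<not> {p, q} \<subseteq> Y"
begin

definition V :: "'a set" where "V = X \<union> C"

definition F :: "'a set set" where
  "F = (\<lambda>Y. insert (f Y) Y) ` nsets X (k - 1) \<union> {Z \<in> nsets X k. \<not> {p, q} \<subseteq> Z}"

section \<open>Basic properties of the vertices and non-edges\<close>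

lemma finite_V: "finite V"
  using finX finC by (simp add: V_def)

lemma card_V: "card V = card X + t + 1"
  using finX finC disj cardC by (simp add: V_def card_Un_disjoint)

lemma f_in_C: "Y \<in> nsets X (k - 1) \<Longrightarrow> f Y \<in> C"
  using onto by blast

lemma insert_f_in_F: "Y \<in> nsets X (k - 1) \<Longrightarrow> insert (f Y) Y \<in> F"
  by (simp add: F_def)

lemma Diff_in_nsets: "Z \<in> nsets X k \<Longrightarrow> z \<in> Z \<Longrightarrow> Z - {z} \<in> nsets X (k - 1)"
  by (auto simp: nsets_def)

text \<open>Colours lie outside \<open>X\<close>, so the trace on \<open>X\<close> recovers
  \<open>Y\<close>.\<close>

lemma insert_f_Int_X:
  assumes "Y \<in> nsets X (k - 1)" shows "insert (f Y) Y \<inter> X = Y"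
proof -
  have "f Y \<notin> X" using f_in_C[OF assms] disj by blast
  moreover have "Y \<subseteq> X" using assms by (simp add: nsets_def)
  ultimately show ?thesis by blast
qed

lemma insert_f_inj:
  assumes "insert (f Y) Y = insert (f Y') Y'" "Y \<in> nsets X (k - 1)" "Y' \<in> nsets X (k - 1)"
  shows "Y = Y'"
  using assms insert_f_Int_X by metis

lemma F_subset: "F \<subseteq> nsets V k"
proof
  fix S assume "S \<in> F"
  then consider Y where "S = insert (f Y) Y" "Y \<in> nsets X (k - 1)" | "S \<in> nsets X k"
    by (auto simp: F_def)
  then show "S \<in> nsets V k"
  proof cases
    case 1
    then have "f Y \<notin> Y" "f Y \<in> C" using f_in_C disj by (auto simp: nsets_def)
    then show ?thesis using 1 k by (auto simp: nsets_def V_def)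
  qed (auto simp: nsets_def V_def)
qed

section \<open>Non-edges inside an \<open>r\<close>-set\<close>

lemma two_nonedges_if_Diff:
  assumes "Z \<in> nsets X k" "Z \<subseteq> R" "a \<in> Z" "b \<in> Z" "a \<noteq> b"
    and "f (Z - {a}) \<in> R" "f (Z - {b}) \<in> R"
  shows "\<exists>S S'. S \<in> F \<and> S' \<in> F \<and> S \<subseteq> R \<and> S' \<subseteq> R \<and> S \<noteq> S'"
proof -
  let ?A = "Z - {a}" and ?B = "Z - {b}"
  have A: "?A \<in> nsets X (k - 1)" and B: "?B \<in> nsets X (k - 1)"
    using assms Diff_in_nsets by auto
  have "?A \<noteq> ?B" using assms by blast
  then have "insert (f ?A) ?A \<noteq> insert (f ?B) ?B" using insert_f_inj A B by blast
  moreover have "insert (f ?A) ?A \<subseteq> R" "insert (f ?B) ?B \<subseteq> R" using assms by auto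
  ultimately show ?thesis using insert_f_in_F A B by blast
qed

text \<open>A set \<open>W\<close> of \<open>k + 1\<close> vertices containing both \<open>p\<close>
  and \<open>q\<close> loses the pair when either is deleted; if \<open>W\<close> misses one of
  them, any two deletions will do.\<close>

lemma two_nonedges_in_large:
  assumes "U \<subseteq> X" "card U \<ge> k + 1"
  shows "\<exists>S S'. S \<in> F \<and> S' \<in> F \<and> S \<subseteq> U \<and> S' \<subseteq> U \<and> S \<noteq> S'"
proof -
  obtain W where W: "W \<subseteq> U" "card W = k + 1" "finite W"
    using obtain_subset_with_card_n[OF assms(2)] by blast
  obtain a b where ab: "a \<in> W" "b \<in> W" "a \<noteq> b" "{p, q} \<subseteq> W \<longrightarrow> a = p \<and> b = q"
  proof (cases "{p, q} \<subseteq> W")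
    case True
    then show ?thesis using that[of p q] pq by auto
  next
    case False
    have "1 < card W" using W k by simp
    then obtain a b where "a \<in> W" "b \<in> W" "a \<noteq> b"
      using W(3) by (metis card_le_Suc0_iff_eq One_nat_def not_le)
    then show ?thesis using that False by blast
  qed
  have "W - {a} \<in> F" "W - {b} \<in> F"
    using W ab assms(1) by (auto simp: F_def nsets_def)
  moreover have "W - {a} \<noteq> W - {b}" using ab by blast
  ultimately show ?thesis using W(1) by blast
qed

text \<open>Outcome \<open>two\<close> bars \<open>R\<close> from being a clique even after one edge
  is added, so only the first two shapes can become cliques.\<close>

lemma r_set_cases:
  assumes R: "R \<in> nsets V (k + t)"
  obtains (full) "C \<subseteq> R" "R \<inter> X \<in> nsets X (k - 1)"
  | (almost) Z where "Z \<in> nsets X k" "\<not> {p, q} \<subseteq> Z" "R = Z \<union> (C - {c0})"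
  | (two) S S' where "S \<in> F" "S' \<in> F" "S \<subseteq> R" "S' \<subseteq> R" "S \<noteq> S'"
proof -
  have RV: "R \<subseteq> V" and finR: "finite R" and cR: "card R = k + t"
    using R by (auto simp: nsets_def)
  have R_eq: "R = (R \<inter> X) \<union> (R \<inter> C)" using RV by (auto simp: V_def)
  have sum: "card (R \<inter> X) + card (R \<inter> C) = k + t"
    using card_Un_disjoint[of "R \<inter> X" "R \<inter> C"] finR disj R_eq cR by fastforce
  have sumC: "card (C - R) + card (R \<inter> C) = t + 1"
    using card_Diff_subset_Int[of C R] finC cardC card_mono[of C "R \<inter> C"]
    by (simp add: Int_commute)
  \<comment> \<open>By \<open>sum\<close> and \<open>sumC\<close>, \<open>R \<inter> X\<close> has
    \<open>k - 1\<close> elements more than \<open>C - R\<close>.\<close>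
  consider "card (C - R) = 0" | "card (C - R) = 1" | "card (C - R) \<ge> 2" by linarith
  then show ?thesis
  proof cases
    case 1
    then have "C \<subseteq> R" using finC by auto
    moreover have "R \<inter> X \<in> nsets X (k - 1)"
      using sum sumC 1 finR by (auto simp: nsets_def)
    ultimately show ?thesis using full by blast
  next
    case 2
    then obtain c where c: "C - R = {c}" by (auto simp: card_1_singleton_iff)
    define Z where "Z = R \<inter> X"
    have Z: "Z \<in> nsets X k" using sum sumC 2 finR by (auto simp: nsets_def Z_def)
    have ZR: "Z \<subseteq> R" and cardZ: "card Z = k" and finZ: "finite Z"
      using Z by (auto simp: Z_def nsets_def)
    have R_Z: "R = Z \<union> (C - {c})" using c R_eq by (auto simp: Z_def)
    show ?thesis
    proof (cases "{p, q} \<subseteq> Z")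
      case True
      \<comment> \<open>If \<open>c0\<close> is the missing colour, deletions keeping
        \<open>p\<close> and \<open>q\<close> have another colour, hence one in \<open>R\<close>;
        \<open>k \<ge> 4\<close> leaves two vertices to delete. Otherwise deleting \<open>p\<close>
        or \<open>q\<close> gives the colour \<open>c0\<close>, which lies in
        \<open>R\<close>.\<close>
      obtain a b where ab: "a \<in> Z" "b \<in> Z" "a \<noteq> b" "f (Z - {a}) \<in> R" "f (Z - {b}) \<in> R"
      proof (cases "c = c0")
        case True
        have "1 < card (Z - {p, q})"
          using \<open>{p, q} \<subseteq> Z\<close> pq cardZ k by (simp add: card_Diff_subset)
        then obtain a b where ab: "a \<in> Z - {p, q}" "b \<in> Z - {p, q}" "a \<noteq> b"
          using finZ by (metis card_le_Suc0_iff_eq finite_Diff One_nat_def not_le)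
        have "f (Z - {x}) \<in> R" if "x \<in> Z - {p, q}" for x
        proof -
          have x: "Z - {x} \<in> nsets X (k - 1)" using Diff_in_nsets[OF Z] that by blast
          have "{p, q} \<subseteq> Z - {x}" using \<open>{p, q} \<subseteq> Z\<close> that by blast
          then show ?thesis using f_c0[OF x] f_in_C[OF x] True c by blast
        qed
        then show ?thesis using that ab by blast
      next
        case False
        then have "c0 \<in> R" using c c0 by (metis DiffI singletonD)
        moreover have "f (Z - {p}) = c0" "f (Z - {q}) = c0"
          using f_c0 Diff_in_nsets[OF Z] True by auto
        ultimately show ?thesis using that[of p q] True pq by auto
      qed
      then show ?thesis using two_nonedges_if_Diff[OF Z ZR] two by blast
    next
      case False
      show ?thesis
      proof (cases "c = c0")
        case True
        then show ?thesis using almost Z False R_Z by blast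
      next
        case neq: False
        then have "c0 \<in> R" using c c0 by (metis DiffI singletonD)
        \<comment> \<open>The two non-edges are \<open>Z\<close> and \<open>Z - {a}\<close> with its
          colour \<open>c0\<close>; only the second meets the core.\<close>
        have "Z \<noteq> {}" using cardZ k by auto
        then obtain a where a: "a \<in> Z" by blast
        let ?Y = "Z - {a}"
        have Y: "?Y \<in> nsets X (k - 1)" using a Diff_in_nsets[OF Z] by blast
        have "f ?Y = c0" using f_c0[OF Y] False by blast
        then have "insert c0 ?Y \<in> F" using insert_f_in_F[OF Y] by simp
        moreover have "Z \<in> F" using Z False by (simp add: F_def)
        moreover have "Z \<noteq> insert c0 ?Y" using c0 disj Z by (auto simp: nsets_def)
        moreover have "insert c0 ?Y \<subseteq> R" using \<open>c0 \<in> R\<close> ZR by blast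
        ultimately show ?thesis using two ZR by blast
      qed
    qed
  next
    case 3
    then have "card (R \<inter> X) \<ge> k + 1" using sum sumC by linarith
    then obtain S S' where "S \<in> F" "S' \<in> F" "S \<subseteq> R \<inter> X" "S' \<subseteq> R \<inter> X" "S \<noteq> S'"
      using two_nonedges_in_large by (meson Int_lower2)
    then show ?thesis using two by blast
  qed
qed

text \<open>A non-edge has at least \<open>k - 1\<close> vertices in \<open>X\<close>, so inside
  \<open>Y \<union> C\<close> its trace must be all of \<open>Y\<close>.\<close>

lemma nonedge_full_iff:
  assumes Y: "Y \<in> nsets X (k - 1)" and S: "S \<in> F"
  shows "S \<subseteq> Y \<union> C \<longleftrightarrow> S = insert (f Y) Y"
proof
  assume sub: "S \<subseteq> Y \<union> C"
  have cY: "card Y = k - 1" "finite Y" "Y \<subseteq> X" using Y by (auto simp: nsets_def)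
  from S consider Y' where "S = insert (f Y') Y'" "Y' \<in> nsets X (k - 1)" | "S \<in> nsets X k"
    by (auto simp: F_def)
  then show "S = insert (f Y) Y"
  proof cases
    case 1
    then have "Y' \<subseteq> Y" "card Y' = k - 1" using sub disj by (auto simp: nsets_def)
    then have "Y' = Y" using cY by (simp add: card_subset_eq)
    then show ?thesis using 1 by simp
  next
    case 2
    then have "S \<subseteq> Y" "card S = k" using sub disj by (auto simp: nsets_def)
    then show ?thesis using cY k card_mono[of Y S] by simp
  qed
qed (use f_in_C[OF Y] in auto)

text \<open>A non-edge with a colour would come from a subset of \<open>Z\<close>, which misses
  \<open>p\<close> or \<open>q\<close> and so has colour \<open>c0\<close>, the core vertex left
  out.\<close>

lemma nonedge_almost_iff:
  assumes Z: "Z \<in> nsets X k" "\<not> {p, q} \<subseteq> Z" and S: "S \<in> F"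
  shows "S \<subseteq> Z \<union> (C - {c0}) \<longleftrightarrow> S = Z"
proof
  assume sub: "S \<subseteq> Z \<union> (C - {c0})"
  from S consider Y where "S = insert (f Y) Y" "Y \<in> nsets X (k - 1)" | "S \<in> nsets X k"
    by (auto simp: F_def)
  then show "S = Z"
  proof cases
    case 1
    then have "Y \<subseteq> Z" using sub disj by (auto simp: nsets_def)
    then have "f Y = c0" using f_c0[OF 1(2)] Z by blast
    then show ?thesis using 1 sub c0 disj Z by (auto simp: nsets_def)
  next
    case 2
    then have "S \<subseteq> Z" using sub disj by (auto simp: nsets_def)
    then show ?thesis using 2 Z by (auto simp: nsets_def card_subset_eq)
  qed
qed auto

section \<open>Cliques in terms of non-edges\<close>

text \<open>\<open>A\<close> holds the edges added back: \<open>{}\<close> for the hypergraph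
  itself, \<open>{S}\<close> after adding \<open>S\<close>.\<close>

lemma nsets_subset_iff:
  assumes "R \<subseteq> V"
  shows "nsets R k \<subseteq> A \<union> (nsets V k - F) \<longleftrightarrow> (\<forall>S\<in>F. S \<subseteq> R \<longrightarrow> S \<in> A)"
proof -
  have "S \<in> nsets R k \<longleftrightarrow> S \<subseteq> R" if "S \<in> F" for S
    using F_subset that by (auto simp: nsets_def)
  moreover have "nsets R k \<subseteq> nsets V k"
    using assms by (rule nsets_mono)
  ultimately show ?thesis by blast
qed

lemma clique_copies_iff:
  "R \<in> clique_copies k r V (nsets V k - F) \<longleftrightarrow> R \<in> nsets V r \<and> (\<forall>S\<in>F. \<not> S \<subseteq> R)"
proof -
  have "nsets R k \<subseteq> nsets V k - F \<longleftrightarrow> (\<forall>S\<in>F. \<not> S \<subseteq> R)" if "R \<in> nsets V r"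
    using nsets_subset_iff[of R "{}"] that by (simp add: nsets_def)
  then show ?thesis by (auto simp: clique_copies_def)
qed

lemma clique_copies_insert_iff:
  "R \<in> clique_copies k r V (insert S (nsets V k - F)) \<longleftrightarrow>
     R \<in> nsets V r \<and> (\<forall>S'\<in>F. S' \<subseteq> R \<longrightarrow> S' = S)"
proof -
  have "nsets R k \<subseteq> insert S (nsets V k - F) \<longleftrightarrow> (\<forall>S'\<in>F. S' \<subseteq> R \<longrightarrow> S' = S)"
    if "R \<in> nsets V r"
    using nsets_subset_iff[of R "{S}"] that by (simp add: nsets_def)
  then show ?thesis by (auto simp: clique_copies_def)
qed

section \<open>Unique saturation\<close>

lemma full_in_nsets:
  assumes "Y \<in> nsets X (k - 1)" shows "Y \<union> C \<in> nsets V (k + t)"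
proof -
  have "Y \<inter> C = {}" "finite Y" "card Y = k - 1" "Y \<subseteq> X"
    using assms disj by (auto simp: nsets_def)
  then show ?thesis using finC cardC k by (auto simp: nsets_def V_def card_Un_disjoint)
qed

lemma almost_in_nsets:
  assumes "Z \<in> nsets X k" shows "Z \<union> (C - {c0}) \<in> nsets V (k + t)"
proof -
  have "Z \<inter> (C - {c0}) = {}" "finite Z" "card Z = k" "Z \<subseteq> X"
    using assms disj by (auto simp: nsets_def)
  then show ?thesis using finC cardC c0 by (auto simp: nsets_def V_def card_Un_disjoint)
qed

lemma no_clique: "clique_copies k (k + t) V (nsets V k - F) = {}"
proof -
  have "\<exists>S\<in>F. S \<subseteq> R" if R: "R \<in> nsets V (k + t)" for R
    using R
  proof (cases rule: r_set_cases)
    case full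
    have "insert (f (R \<inter> X)) (R \<inter> X) \<subseteq> R" using f_in_C[OF full(2)] full(1) by blast
    then show ?thesis using insert_f_in_F[OF full(2)] by (rule bexI)
  next
    case (almost Z)
    then show ?thesis by (auto simp: F_def)
  qed auto
  then show ?thesis using clique_copies_iff by blast
qed

text \<open>Uniqueness: \<open>two\<close> is impossible, the shapes \<open>full\<close> and
  \<open>almost\<close> cannot share their non-edge because only the former's meets the core, and
  within a shape \<open>S\<close> determines \<open>R\<close>.\<close>

lemma unique_clique:
  assumes S: "S \<in> F"
  shows "\<exists>!R. R \<in> clique_copies k (k + t) V (insert S (nsets V k - F))"
proof -
  from S consider (A) Y where "S = insert (f Y) Y" "Y \<in> nsets X (k - 1)"
    | (B) "S \<in> nsets X k" "\<not> {p, q} \<subseteq> S"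
    by (auto simp: F_def)
  then show ?thesis
  proof cases
    case A
    show ?thesis unfolding clique_copies_insert_iff
    proof (rule ex1I[of _ "Y \<union> C"])
      show "Y \<union> C \<in> nsets V (k + t) \<and> (\<forall>S'\<in>F. S' \<subseteq> Y \<union> C \<longrightarrow> S' = S)"
        using full_in_nsets nonedge_full_iff A by blast
    next
      fix R assume R: "R \<in> nsets V (k + t) \<and> (\<forall>S'\<in>F. S' \<subseteq> R \<longrightarrow> S' = S)"
      then have "R \<in> nsets V (k + t)" by blast
      then show "R = Y \<union> C"
      proof (cases rule: r_set_cases)
        case full
        let ?Y = "R \<inter> X"
        have "insert (f ?Y) ?Y \<subseteq> R" using f_in_C[OF full(2)] full(1) by blast
        then have "insert (f ?Y) ?Y = S" using R insert_f_in_F[OF full(2)] by simp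
        then have "?Y = Y" using A full insert_f_inj by blast
        then show ?thesis using full R by (auto simp: nsets_def V_def)
      next
        case (almost Z)
        then have "Z \<in> F" "Z \<subseteq> R" by (auto simp: F_def)
        then have "Z = S" using R by blast
        then show ?thesis using A f_in_C[OF A(2)] almost(1) disj by (auto simp: nsets_def)
      next
        case two
        then show ?thesis using R by blast
      qed
    qed
  next
    case B
    show ?thesis unfolding clique_copies_insert_iff
    proof (rule ex1I[of _ "S \<union> (C - {c0})"])
      show "S \<union> (C - {c0}) \<in> nsets V (k + t) \<and> (\<forall>S'\<in>F. S' \<subseteq> S \<union> (C - {c0}) \<longrightarrow> S' = S)"
        using almost_in_nsets nonedge_almost_iff B by blast
    next
      fix R assume R: "R \<in> nsets V (k + t) \<and> (\<forall>S'\<in>F. S' \<subseteq> R \<longrightarrow> S' = S)"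
      then have "R \<in> nsets V (k + t)" by blast
      then show "R = S \<union> (C - {c0})"
      proof (cases rule: r_set_cases)
        case full
        let ?Y = "R \<inter> X"
        have "insert (f ?Y) ?Y \<subseteq> R" using f_in_C[OF full(2)] full(1) by blast
        then have "insert (f ?Y) ?Y = S" using R insert_f_in_F[OF full(2)] by simp
        then show ?thesis using B f_in_C[OF full(2)] disj by (auto simp: nsets_def)
      next
        case (almost Z)
        then have "Z \<in> F" "Z \<subseteq> R" by (auto simp: F_def)
        then show ?thesis using R almost by blast
      next
        case two
        then show ?thesis using R by blast
      qed
    qed
  qed
qed

text \<open>This excludes dominating vertices: a vertex of \<open>X\<close> extends to a
  \<open>(k - 1)\<close>-set, and a core vertex occurs as a colour.\<close>

lemma in_nonedge:
  assumes "v \<in> V" shows "\<exists>S\<in>F. v \<in> S"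
proof (cases "v \<in> X")
  case True
  have "card (X - {v}) \<ge> k - 2" using True finX cardX by simp
  then obtain W where W: "W \<subseteq> X - {v}" "card W = k - 2" "finite W"
    by (rule obtain_subset_with_card_n)
  have "v \<notin> W" "W \<subseteq> X" using W(1) by auto
  then have "insert v W \<in> nsets X (k - 1)" using W(2,3) True k by (simp add: nsets_def)
  then have "insert (f (insert v W)) (insert v W) \<in> F" by (rule insert_f_in_F)
  then show ?thesis by (rule rev_bexI) simp
next
  case False
  then have "v \<in> f ` nsets X (k - 1)" using assms onto by (simp add: V_def)
  then obtain Y where "Y \<in> nsets X (k - 1)" "v = f Y" by blast
  then show ?thesis using insert_f_in_F[of Y] by (intro rev_bexI) auto
qed

theorem primitive: "primitive_uniquely_saturated k (k + t) V (nsets V k - F)"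
proof -
  have "nsets V k - (nsets V k - F) = F" using F_subset by blast
  moreover have "\<nexists>v. dominating k V (nsets V k - F) v"
    using in_nonedge F_subset unfolding dominating_def by blast
  ultimately show ?thesis
    using no_clique unique_clique finite_V
    by (simp add: primitive_uniquely_saturated_def uniquely_saturated_def uniform_hypergraph_def)
qed

end

section \<open>A concrete colouring by the least missing number\<close>

theorem theorem2:
  fixes k r n :: nat
  assumes "k \<ge> 4" and "k < r" and "r \<le> 2 * k - 3" and "n > r"
  shows "\<exists>(V :: nat set) E. card V = n \<and> primitive_uniquely_saturated k r V E"
proof -
  define t where "t = r - k"
  define N where "N = n - t - 1"
  have r: "r = k + t" and t: "t \<ge> 1" "t + 3 \<le> k" and N: "N \<ge> k" "n = N + t + 1"
    using assms by (auto simp: t_def N_def)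
  define mex where "mex Y = (LEAST i. i \<notin> Y)" for Y :: "nat set"
  \<comment> \<open>Truncated subtraction merges the \<open>mex\<close> values 0 and 1, that is, the
    sets missing 0 or 1, into the colour \<open>N\<close>, which serves as \<open>c0\<close>. The
    cap \<open>min t\<close> keeps larger values in the core.\<close>
  define f where "f Y = N + min t (mex Y - 1)" for Y
  have mex_notin: "mex Y \<notin> Y" if "finite Y" for Y
    unfolding mex_def by (rule LeastI_ex) (use ex_new_if_finite[OF infinite_UNIV_nat that] in blast)
  have mex_le: "mex Y \<le> i" if "i \<notin> Y" for Y i
    unfolding mex_def using that by (rule Least_le)
  interpret core_colouring k t "{..<N}" "{N..N + t}" N 0 1 f
  proof
    show "f ` nsets {..<N} (k - 1) = {N..N + t}"
    proof (intro equalityI subsetI)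
      fix c assume c: "c \<in> {N..N + t}"
      \<comment> \<open>The only number below \<open>k\<close> missing from \<open>?Y\<close> is
        \<open>?j\<close>, which is at most \<open>t + 1\<close> and hence below \<open>k\<close> by
        \<open>t + 3 \<le> k\<close>.\<close>
      let ?j = "c - N + 1"
      let ?Y = "{..<k} - {?j}"
      have j: "?j < k" using c t by auto
      then have "?Y \<in> nsets {..<N} (k - 1)" using N by (auto simp: nsets_def)
      moreover have "mex ?Y = ?j"
      proof (rule antisym)
        show "mex ?Y \<le> ?j" by (rule mex_le) simp
        show "?j \<le> mex ?Y" using mex_notin[of ?Y] j by force
      qed
      then have "f ?Y = c" using c by (auto simp: f_def)
      ultimately show "c \<in> f ` nsets {..<N} (k - 1)" by (metis imageI)
    qed (auto simp: f_def)
  next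
    fix Y assume "Y \<in> nsets {..<N} (k - 1)"
    then have "mex Y \<notin> Y" using mex_notin by (simp add: nsets_def)
    then have "mex Y \<le> 1 \<longleftrightarrow> \<not> {0, 1} \<subseteq> Y"
      using mex_le[of 0 Y] mex_le[of 1 Y] by (auto simp: le_Suc_eq)
    \<comment> \<open>As \<open>t \<ge> 1\<close>, the capped value is 0 only if
      \<open>mex Y - 1\<close> is.\<close>
    then show "f Y = N \<longleftrightarrow> \<not> {0, 1} \<subseteq> Y" using t by (auto simp: f_def min_def)
  qed (use assms N in auto)
  have "card V = n" using card_V N by simp
  then show ?thesis using primitive r by blast
qed

end
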